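(* Let $a\ge 0$ and let $r>0$, $p>0$ and $q$ be continuous real functions on $[a,\infty)$. If $\int^\infty q(t)\,dt=-\infty$ and $\int^\infty p(t)\,dt=+\infty$, then the equation $(r(x)y'')''-(q(x)y')'=p(x)y$ is systems-conjugate in $(a,\infty)$.
   Context: For a function $y$ put $y_1=ry''$ and $Ty=(ry'')'-qy'$. A solution of $(ry'')''-(qy')'=py$ is a function $y$ such that $y,y',y_1,Ty$ are continuously differentiable and $(Ty)'=py$. The systems-conjugate point $\hat\eta_1(a)$ is the smallest $b\in(a,\infty)$ for which there is a nontrivial solution with $y(a)=y_1(a)=y(b)=y_1(b)=0$. The equation is systems-conjugate in $(a,\infty)$ if $\hat\eta_1(a)$ exists (i.e. such a $b$ exists). $\int^\infty f=\pm\infty$ means $\lim_{x\to\infty}\int_a^x f(t)\,dt=\pm\infty$. *)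

theory Defs
  imports "HOL-Analysis.Analysis"
begin

text \<open>
  Everything is a function on the closed half-line \<open>[a, \<infinity>)\<close>, so the derivative is taken
  within \<open>{a..}\<close> (one-sided at \<open>a\<close>); values to the left of \<open>a\<close> are irrelevant.
\<close>

definition deriv_from :: "real \<Rightarrow> (real \<Rightarrow> real) \<Rightarrow> real \<Rightarrow> real" where
  "deriv_from a f x = vector_derivative f (at x within {a..})"

definition C1_from :: "real \<Rightarrow> (real \<Rightarrow> real) \<Rightarrow> bool" where
  "C1_from a f \<longleftrightarrow> f differentiable_on {a..} \<and> continuous_on {a..} (deriv_from a f)"

text \<open>The quasi-derivatives \<open>y\<^sub>1 = r y''\<close> and \<open>T y = (r y'')' - q y'\<close>.\<close>

definition quasi1 :: "real \<Rightarrow> (real \<Rightarrow> real) \<Rightarrow> (real \<Rightarrow> real) \<Rightarrow> real \<Rightarrow> real" where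
  "quasi1 a r y x = r x * deriv_from a (deriv_from a y) x"

definition quasiT ::
  "real \<Rightarrow> (real \<Rightarrow> real) \<Rightarrow> (real \<Rightarrow> real) \<Rightarrow> (real \<Rightarrow> real) \<Rightarrow> real \<Rightarrow> real" where
  "quasiT a r q y x = deriv_from a (quasi1 a r y) x - q x * deriv_from a y x"

definition is_solution ::
  "real \<Rightarrow> (real \<Rightarrow> real) \<Rightarrow> (real \<Rightarrow> real) \<Rightarrow> (real \<Rightarrow> real) \<Rightarrow> (real \<Rightarrow> real) \<Rightarrow> bool" where
  "is_solution a r q p y \<longleftrightarrow>
     C1_from a y \<and> C1_from a (deriv_from a y) \<and>
     C1_from a (quasi1 a r y) \<and> C1_from a (quasiT a r q y) \<and>
     (\<forall>x\<ge>a. deriv_from a (quasiT a r q y) x = p x * y x)"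

definition systems_conjugate_to ::
  "real \<Rightarrow> (real \<Rightarrow> real) \<Rightarrow> (real \<Rightarrow> real) \<Rightarrow> (real \<Rightarrow> real) \<Rightarrow> real \<Rightarrow> bool" where
  "systems_conjugate_to a r q p b \<longleftrightarrow>
     a < b \<and>
     (\<exists>y. is_solution a r q p y \<and> (\<exists>x\<ge>a. y x \<noteq> 0) \<and>
          y a = 0 \<and> quasi1 a r y a = 0 \<and> y b = 0 \<and> quasi1 a r y b = 0)"

text \<open>The systems-conjugate point of \<open>a\<close> is the smallest such \<open>b\<close>, which need not exist
  a priori; hence it is given as a predicate rather than a function of \<open>a\<close>.\<close>

definition is_systems_conjugate_point ::
  "real \<Rightarrow> (real \<Rightarrow> real) \<Rightarrow> (real \<Rightarrow> real) \<Rightarrow> (real \<Rightarrow> real) \<Rightarrow> real \<Rightarrow> bool" where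
  "is_systems_conjugate_point a r q p b \<longleftrightarrow>
     systems_conjugate_to a r q p b \<and> (\<forall>c. systems_conjugate_to a r q p c \<longrightarrow> b \<le> c)"

definition systems_conjugate ::
  "real \<Rightarrow> (real \<Rightarrow> real) \<Rightarrow> (real \<Rightarrow> real) \<Rightarrow> (real \<Rightarrow> real) \<Rightarrow> bool" where
  "systems_conjugate a r q p \<longleftrightarrow> (\<exists>b. is_systems_conjugate_point a r q p b)"

end

theory Submission
  imports Defs
begin

text \<open>
  With \<open>z = y'\<close>, \<open>w = r y''\<close> and \<open>T = T y\<close> the equation becomes the linear first-order system
  \<open>y' = z\<close>, \<open>z' = w / r\<close>, \<open>w' = T + q z\<close>, \<open>T' = p y\<close>. The solutions with \<open>y = w = 0\<close> at \<open>a\<close> form a plane, and \<open>b\<close>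
  is conjugate to \<open>a\<close> exactly when the determinant \<open>D = y\<^sub>1 w\<^sub>2 - y\<^sub>2 w\<^sub>1\<close> of a basis vanishes at \<open>b\<close>
  (\<open>conjugate_iff_determinant_zero\<close>). Global existence and uniqueness of solutions come from Picard
  iteration and an energy estimate.

  The system is Hamiltonian and the plane is Lagrangian, so besides \<open>D\<close> only four of its \<open>2 \<times> 2\<close> minors
  matter, and these five functions satisfy a closed linear system and one quadratic relation
  (\<open>pluecker_system\<close>). Quotients of the minors are entries of solutions of matrix Riccati equations. If \<open>D\<close> had no
  zero to the right of \<open>a\<close>, the divergence of the integral of \<open>p\<close> would force a pole of the
  Riccati matrix that takes \<open>(z, T)\<close> to \<open>(w, y)\<close> to be passed, after which this matrix is positive
  definite; but its upper left entry has derivative at most \<open>q\<close>, and the divergence of the integral of \<open>q\<close>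
  makes it negative (\<open>determinant_zero_exists\<close>). Working with the minors themselves allows the pole
  to be crossed without a case analysis.

  Finally \<open>D\<close> is positive just to the right of \<open>a\<close> (\<open>determinant_pos_near_start\<close>), so its zeros
  beyond \<open>a\<close> have a least element, the conjugate point.
\<close>

section \<open>Calculus on a closed half-line\<close>

lemma at_within_Icc_atLeast:
  fixes a t b :: real
  assumes "a \<le> t" "t < b"
  shows "at t within {a..b} = at t within {a..}"
  by (rule at_within_nhd[of _ "{..<b}"]) (use assms in auto)

lemma continuous_on_half_line:
  fixes g :: "real \<Rightarrow> 'a::topological_space"
  assumes "\<And>b. a \<le> b \<Longrightarrow> continuous_on {a..b} g"
  shows "continuous_on {a..} g"
  unfolding continuous_on_eq_continuous_within
proof
  fix t assume "t \<in> {a..}"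
  then show "continuous (at t within {a..}) g"
    using assms[of "t+1"] at_within_Icc_atLeast[of a t "t+1"]
    by (simp add: continuous_on_eq_continuous_within) (metis atLeastAtMost_iff less_add_one less_imp_le)
qed

lemma mean_value_half_line:
  fixes f f' :: "real \<Rightarrow> real"
  assumes f: "\<And>t. c \<le> t \<Longrightarrow> (f has_real_derivative f' t) (at t within {a..})"
    and "a \<le> c" "c < d"
  obtains s where "c < s" "s < d" "f d - f c = f' s * (d - c)"
proof -
  have "(f has_derivative (*) (f' t)) (at t within {c..d})" if "t \<in> {c..d}" for t
    using f[of t] that \<open>a \<le> c\<close> unfolding has_field_derivative_def
    by (auto elim: has_derivative_subset)
  then have "\<exists>s\<in>{c<..<d}. f d - f c = f' s * (d - c)"
    using \<open>c < d\<close> by (intro mvt_simple) auto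
  then obtain s where "s \<in> {c<..<d}" "f d - f c = f' s * (d - c)"
    by blast
  then show thesis by (intro that) auto
qed

lemma half_line_nondecreasing:
  fixes f f' :: "real \<Rightarrow> real"
  assumes "\<And>t. c \<le> t \<Longrightarrow> (f has_real_derivative f' t) (at t within {a..})"
    and "a \<le> c" "c \<le> d" and "\<And>t. c < t \<Longrightarrow> f' t \<ge> 0"
  shows "f c \<le> f d"
proof (cases "c = d")
  case False
  with assms mean_value_half_line[of c f f' a d] show ?thesis
    by (metis diff_ge_0_iff_ge less_eq_real_def mult_nonneg_nonneg)
qed simp

lemma integral_has_real_derivative_half_line:
  fixes f :: "real \<Rightarrow> real"
  assumes f: "continuous_on {a..} f" and t: "a \<le> t"
  shows "((\<lambda>x. integral {a..x} f) has_real_derivative f t) (at t within {a..})"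
proof -
  have "((\<lambda>x. integral {a..x} f) has_vector_derivative f t) (at t within {a..t+1})"
    using t continuous_on_subset[OF f, of "{a..t+1}"]
    by (intro integral_has_vector_derivative) auto
  then show ?thesis
    using at_within_Icc_atLeast[of a t "t+1"] t
    by (simp add: has_real_derivative_iff_has_vector_derivative)
qed

lemma deriv_from_eq:
  assumes "(f has_real_derivative D) (at x within {a..})" "a \<le> x"
  shows "deriv_from a f x = D"
proof -
  have "(f has_vector_derivative D) (at x within {a..x+1})"
    using assms at_within_Icc_atLeast[of a x "x+1"]
    by (simp add: has_real_derivative_iff_has_vector_derivative)
  then have "vector_derivative f (at x within {a..x+1}) = D"
    using assms(2) by (intro vector_derivative_within_closed_interval) auto
  then show ?thesis
    using assms(2) at_within_Icc_atLeast[of a x "x+1"] by (simp add: deriv_from_def)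
qed

text \<open>
  Together with the next lemma this trades the derivatives \<open>deriv_from\<close>, which are defined by
  choice and only meaningful where a derivative exists, for honest derivative statements.
\<close>
lemma C1_from_imp_derivative:
  assumes "C1_from a f" "a \<le> x"
  shows "(f has_real_derivative deriv_from a f x) (at x within {a..})"
proof -
  from assms have "f differentiable (at x within {a..})"
    by (auto simp: C1_from_def differentiable_on_def)
  then obtain D where D: "(f has_real_derivative D) (at x within {a..})"
    by (auto simp: real_differentiable_def)
  with deriv_from_eq[OF D] assms show ?thesis by simp
qed

lemma C1_fromI:
  assumes "\<And>x. a \<le> x \<Longrightarrow> (f has_real_derivative g x) (at x within {a..})"
    and "continuous_on {a..} g"
  shows "C1_from a f"
  unfolding C1_from_def
proof
  show "f differentiable_on {a..}"
    using assms(1) by (auto simp: differentiable_on_def real_differentiable_def)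
  show "continuous_on {a..} (deriv_from a f)"
    using assms(2)
  proof (rule continuous_on_eq)
    show "g x = deriv_from a f x" if "x \<in> {a..}" for x
      using deriv_from_eq[OF assms(1)] that by simp
  qed
qed

section \<open>Initial value problems with a Lipschitz right-hand side\<close>

text \<open>
  Picard iterates of \<open>u' = f t u\<close>, \<open>u a = c\<close>, as functions on the whole half-line: each compact
  interval has its own Lipschitz constant, but the iterates do not depend on the interval, so their
  limits on different intervals agree and the solution comes out global without any gluing.
\<close>
primrec picard :: "real \<Rightarrow> 'a::banach \<Rightarrow> (real \<Rightarrow> 'a \<Rightarrow> 'a) \<Rightarrow> nat \<Rightarrow> real \<Rightarrow> 'a" where
  "picard a c f 0 t = c"
| "picard a c f (Suc n) t = c + integral {a..t} (\<lambda>s. f s (picard a c f n s))"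

text \<open>
  The first assumption replaces joint continuity of \<open>f\<close>: only compositions with continuous curves
  are ever integrated, and in this form it is a routine continuity goal for a concrete system.
\<close>
context
  fixes f :: "real \<Rightarrow> 'a::banach \<Rightarrow> 'a" and a :: real
  assumes cont: "\<And>u. continuous_on {a..} u \<Longrightarrow> continuous_on {a..} (\<lambda>s. f s (u s))"
    and lip: "\<And>b. \<exists>L\<ge>0. \<forall>s\<in>{a..b}. \<forall>u v. norm (f s u - f s v) \<le> L * norm (u - v)"
begin

lemma continuous_on_picard: "continuous_on {a..} (picard a c f n)"
proof (induction n)
  case (Suc n)
  show ?case
  proof (rule continuous_on_half_line)
    fix b assume "a \<le> b"
    have "continuous_on {a..b} (\<lambda>s. f s (picard a c f n s))"
      using cont[OF Suc] by (rule continuous_on_subset) auto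
    then show "continuous_on {a..b} (picard a c f (Suc n))"
      by (auto intro!: continuous_intros indefinite_integral_continuous_1
          integrable_continuous_real)
  qed
qed simp

lemma picard_integrand_integrable:
  assumes "continuous_on {a..} u"
  shows "(\<lambda>s. f s (u s)) integrable_on {a..t}"
  using cont[OF assms] by (intro integrable_continuous_real) (auto elim: continuous_on_subset)

text \<open>
  Integrating the Lipschitz estimate turns \<open>(t - a) ^ n / n!\<close> into \<open>(t - a) ^ (n + 1) / (n + 1)!\<close>;
  so the increments are dominated by an exponential series, whatever the length of the interval.
\<close>
lemma picard_step_bound:
  assumes L: "L \<ge> 0" "\<forall>s\<in>{a..b}. \<forall>u v. norm (f s u - f s v) \<le> L * norm (u - v)"
    and C: "\<forall>t\<in>{a..b}. norm (picard a c f 1 t - c) \<le> C"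
    and t: "t \<in> {a..b}"
  shows "norm (picard a c f (Suc n) t - picard a c f n t) \<le> C * (L * (t - a)) ^ n / fact n"
  using t
proof (induction n arbitrary: t)
  case (Suc n)
  let ?g = "\<lambda>n s. f s (picard a c f n s)"
  let ?h = "\<lambda>s. L * (C * (L * (s - a)) ^ n / fact n)"
  have gi: "?g n integrable_on {a..t}" for n
    by (rule picard_integrand_integrable[OF continuous_on_picard])
  have hi: "(?h has_integral
      C * (L * (t - a)) ^ Suc n / fact (Suc n) - C * (L * (a - a)) ^ Suc n / fact (Suc n)) {a..t}"
  proof (rule fundamental_theorem_of_calculus)
    show "a \<le> t" using Suc.prems by simp
    fix s
    have "((\<lambda>s. (C * L ^ Suc n / fact (Suc n)) * (s - a) ^ Suc n) has_real_derivative
        (C * L ^ Suc n / fact (Suc n)) * (Suc n * (s - a) ^ n)) (at s within {a..t})"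
    proof (rule DERIV_cmult)
      have "((\<lambda>s. s - a) has_real_derivative 1) (at s within {a..t})"
        by (auto intro!: derivative_eq_intros)
      from DERIV_power_Suc[OF this, of n]
      show "((\<lambda>s. (s - a) ^ Suc n) has_real_derivative Suc n * (s - a) ^ n) (at s within {a..t})"
        by (simp del: power_Suc)
    qed
    also have "(C * L ^ Suc n / fact (Suc n)) * (Suc n * (s - a) ^ n) = ?h s"
      by (simp add: power_mult_distrib divide_simps del: of_nat_Suc)
    finally show "((\<lambda>s. C * (L * (s - a)) ^ Suc n / fact (Suc n)) has_vector_derivative ?h s)
        (at s within {a..t})"
      by (simp add: has_real_derivative_iff_has_vector_derivative power_mult_distrib mult_ac)
  qed
  have "norm (picard a c f (Suc (Suc n)) t - picard a c f (Suc n) t)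
      = norm (integral {a..t} (\<lambda>s. ?g (Suc n) s - ?g n s))"
    using gi by (subst integral_diff) (auto simp del: picard.simps(2) simp: picard.simps(2)[of _ _ _ _ t])
  also have "\<dots> \<le> integral {a..t} ?h"
  proof (rule integral_norm_bound_integral)
    show "(\<lambda>s. ?g (Suc n) s - ?g n s) integrable_on {a..t}"
      using gi by (intro integrable_diff)
    show "?h integrable_on {a..t}" using hi by blast
    fix s assume s: "s \<in> {a..t}"
    then have "norm (?g (Suc n) s - ?g n s) \<le> L * norm (picard a c f (Suc n) s - picard a c f n s)"
      using L(2) Suc.prems by auto
    also have "\<dots> \<le> ?h s"
      using Suc.IH[of s] s Suc.prems L(1) by (intro mult_left_mono) auto
    finally show "norm (?g (Suc n) s - ?g n s) \<le> ?h s" .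
  qed
  also have "\<dots> = C * (L * (t - a)) ^ Suc n / fact (Suc n)"
    using integral_unique[OF hi] by simp
  finally show ?case .
qed (use C in auto)

lemma picard_uniform_limit:
  obtains \<phi> where "\<And>b. uniform_limit {a..b} (picard a c f) \<phi> sequentially"
proof -
  have "\<exists>g. uniform_limit {a..b} (picard a c f) g sequentially" for b
  proof -
    obtain L where L: "L \<ge> 0" "\<forall>s\<in>{a..b}. \<forall>u v. norm (f s u - f s v) \<le> L * norm (u - v)"
      using lip by blast
    have "continuous_on {a..b} (\<lambda>t. picard a c f 1 t - c)"
      by (intro continuous_intros continuous_on_subset[OF continuous_on_picard]) auto
    then have "compact ((\<lambda>t. picard a c f 1 t - c) ` {a..b})"
      by (rule compact_continuous_image) auto
    then obtain C where C: "\<forall>t\<in>{a..b}. norm (picard a c f 1 t - c) \<le> C"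
      by (auto dest!: compact_imp_bounded simp: bounded_iff)
    have C': "\<bar>C\<bar> \<ge> 0" "\<forall>t\<in>{a..b}. norm (picard a c f 1 t - c) \<le> \<bar>C\<bar>"
      using C by force+
    let ?d = "\<lambda>n t. picard a c f (Suc n) t - picard a c f n t"
    let ?M = "\<lambda>n. \<bar>C\<bar> * (L * (b - a)) ^ n / fact n"
    have "summable (\<lambda>n. \<bar>C\<bar> * ((L * (b - a)) ^ n /\<^sub>R fact n))"
      by (intro summable_mult summable_exp_generic)
    then have "summable ?M" by (simp add: field_simps)
    moreover have "norm (?d n t) \<le> ?M n" if "t \<in> {a..b}" for n t
    proof -
      have "norm (?d n t) \<le> \<bar>C\<bar> * (L * (t - a)) ^ n / fact n"
        using L C' that by (intro picard_step_bound) auto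
      also have "\<dots> \<le> ?M n"
        using L that by (intro divide_right_mono mult_left_mono power_mono) auto
      finally show ?thesis .
    qed
    ultimately have "uniform_limit {a..b} (\<lambda>n t. \<Sum>i<n. ?d i t) (\<lambda>t. suminf (\<lambda>i. ?d i t)) sequentially"
      by (intro Weierstrass_m_test)
    then have "uniform_limit {a..b} (\<lambda>n t. c + (\<Sum>i<n. ?d i t)) (\<lambda>t. c + suminf (\<lambda>i. ?d i t)) sequentially"
      by (intro uniform_limit_add uniform_limit_const)
    moreover have "c + (\<Sum>i<n. ?d i t) = picard a c f n t" for n t
      by (subst sum_lessThan_telescope) simp
    ultimately show ?thesis by auto
  qed
  then obtain g where g: "\<And>b. uniform_limit {a..b} (picard a c f) (g b) sequentially"
    by metis
  have "uniform_limit {a..b} (picard a c f) (\<lambda>t. g t t) sequentially" for b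
  proof -
    have gt: "g b t = g t t" if "t \<in> {a..b}" for t
    proof (rule LIMSEQ_unique)
      show "(\<lambda>n. picard a c f n t) \<longlonglongrightarrow> g b t" "(\<lambda>n. picard a c f n t) \<longlonglongrightarrow> g t t"
        using g[of b] g[of t] that by (auto intro: tendsto_uniform_limitI)
    qed
    show ?thesis
      using g[of b] uniform_limit_cong'[of "{a..b}" "picard a c f" "picard a c f" "g b" "\<lambda>t. g t t"] gt
      by auto
  qed
  then show thesis by (rule that)
qed

lemma initial_value_problem_global:
  obtains \<phi> where "\<phi> a = c"
    "\<And>t. t \<ge> a \<Longrightarrow> (\<phi> has_vector_derivative f t (\<phi> t)) (at t within {a..})"
proof -
  obtain \<phi> where lim: "\<And>b. uniform_limit {a..b} (picard a c f) \<phi> sequentially"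
    using picard_uniform_limit by blast
  have c\<phi>: "continuous_on {a..} \<phi>"
  proof (rule continuous_on_half_line)
    fix b
    show "continuous_on {a..b} \<phi>"
      using lim[of b] by (rule uniform_limit_theorem[rotated])
        (auto intro!: always_eventually continuous_on_subset[OF continuous_on_picard])
  qed
  have eq: "\<phi> t = c + integral {a..t} (\<lambda>s. f s (\<phi> s))" if "t \<ge> a" for t
  proof (rule LIMSEQ_unique)
    show "(\<lambda>n. picard a c f (Suc n) t) \<longlonglongrightarrow> \<phi> t"
      using lim[of t] that by (intro LIMSEQ_Suc tendsto_uniform_limitI) auto
    obtain L where L: "L \<ge> 0" "\<forall>s\<in>{a..t}. \<forall>u v. norm (f s u - f s v) \<le> L * norm (u - v)"
      using lip by blast
    have "uniform_limit {a..t} (\<lambda>n s. f s (picard a c f n s)) (\<lambda>s. f s (\<phi> s)) sequentially"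
    proof (rule uniform_limitI)
      fix e :: real assume "e > 0"
      then have "\<forall>\<^sub>F n in sequentially. \<forall>s\<in>{a..t}. dist (picard a c f n s) (\<phi> s) < e / (L + 1)"
        using lim[of t] L by (intro uniform_limitD) auto
      then show "\<forall>\<^sub>F n in sequentially. \<forall>s\<in>{a..t}. dist (f s (picard a c f n s)) (f s (\<phi> s)) < e"
      proof (rule eventually_mono, intro ballI)
        fix n s
        assume n: "\<forall>s\<in>{a..t}. dist (picard a c f n s) (\<phi> s) < e / (L + 1)" and s: "s \<in> {a..t}"
        have "dist (f s (picard a c f n s)) (f s (\<phi> s)) \<le> L * dist (picard a c f n s) (\<phi> s)"
          using L(2) s by (auto simp: dist_norm)
        also have "\<dots> \<le> (L + 1) * dist (picard a c f n s) (\<phi> s)"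
          by (intro mult_right_mono) auto
        also have "\<dots> < e"
          using n s L(1) by (auto simp: field_simps)
        finally show "dist (f s (picard a c f n s)) (f s (\<phi> s)) < e" .
      qed
    qed
    then have "(\<lambda>n. integral {a..t} (\<lambda>s. f s (picard a c f n s))) \<longlonglongrightarrow> integral {a..t} (\<lambda>s. f s (\<phi> s))"
    proof (rule uniform_limit_integral)
      show "continuous_on {a..t} (\<lambda>s. f s (picard a c f n s))" for n
        using cont[OF continuous_on_picard] by (rule continuous_on_subset) auto
    next
      fix I J
      assume "\<And>n. ((\<lambda>s. f s (picard a c f n s)) has_integral I n) {a..t}"
        "((\<lambda>s. f s (\<phi> s)) has_integral J) {a..t}" "I \<longlonglongrightarrow> J"
      moreover from this have "I = (\<lambda>n. integral {a..t} (\<lambda>s. f s (picard a c f n s)))"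
        by (metis integral_unique)
      ultimately show ?thesis by (simp add: integral_unique)
    qed auto
    then show "(\<lambda>n. picard a c f (Suc n) t) \<longlonglongrightarrow> c + integral {a..t} (\<lambda>s. f s (\<phi> s))"
      by (auto intro!: tendsto_intros)
  qed
  show thesis
  proof (rule that)
    show "\<phi> a = c" using eq[of a] by simp
    fix t assume t: "t \<ge> a"
    have "((\<lambda>t. c + integral {a..t} (\<lambda>s. f s (\<phi> s))) has_vector_derivative 0 + f t (\<phi> t))
        (at t within {a..t+1})"
      using t continuous_on_subset[OF cont[OF c\<phi>], of "{a..t+1}"]
      by (intro derivative_intros integral_has_vector_derivative) auto
    then have "((\<lambda>t. c + integral {a..t} (\<lambda>s. f s (\<phi> s))) has_vector_derivative f t (\<phi> t))
        (at t within {a..})"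
      using at_within_Icc_atLeast[of a t "t+1"] t by simp
    then show "(\<phi> has_vector_derivative f t (\<phi> t)) (at t within {a..})"
      by (rule has_vector_derivative_transform[rotated 2]) (use t eq in auto)
  qed
qed

end

text \<open>
  For the difference \<open>e = u - v\<close> of two solutions, \<open>(e \<bullet> e)' = 2 (e \<bullet> (f t u - f t v)) \<le> 2 L (e \<bullet> e)\<close>,
  so \<open>exp (- 2 L t) (e \<bullet> e)\<close> is nonincreasing; it starts at zero and cannot be negative.
\<close>
lemma initial_value_problem_unique:
  fixes f :: "real \<Rightarrow> 'a::real_inner \<Rightarrow> 'a"
  assumes lip: "\<And>b. \<exists>L\<ge>0. \<forall>s\<in>{a..b}. \<forall>u v. norm (f s u - f s v) \<le> L * norm (u - v)"
    and u: "\<And>t. t \<ge> a \<Longrightarrow> (u has_vector_derivative f t (u t)) (at t within {a..})"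
    and v: "\<And>t. t \<ge> a \<Longrightarrow> (v has_vector_derivative f t (v t)) (at t within {a..})"
    and init: "u a = v a" and t: "t \<ge> a"
  shows "u t = v t"
proof -
  obtain L where L: "L \<ge> 0" "\<forall>s\<in>{a..t}. \<forall>u v. norm (f s u - f s v) \<le> L * norm (u - v)"
    using lip by blast
  let ?E = "\<lambda>s. exp (- (2 * L) * s) * ((u s - v s) \<bullet> (u s - v s))"
  let ?E' = "\<lambda>s. exp (- (2 * L) * s) *
    (2 * ((u s - v s) \<bullet> (f s (u s) - f s (v s))) - 2 * L * ((u s - v s) \<bullet> (u s - v s)))"
  have D: "(?E has_real_derivative ?E' s) (at s within {a..})" if s: "s \<ge> a" for s
  proof -
    have "(u has_derivative (\<lambda>h. h *\<^sub>R f s (u s))) (at s within {a..})"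
        "(v has_derivative (\<lambda>h. h *\<^sub>R f s (v s))) (at s within {a..})"
      using u[of s] v[of s] s by (auto simp: has_vector_derivative_def)
    then have "(?E has_derivative (\<lambda>h. h * ?E' s)) (at s within {a..})"
      by (auto intro!: derivative_eq_intros simp: algebra_simps inner_commute)
    then show ?thesis
      by (simp add: has_field_derivative_def mult.commute[of _ "?E' s"] mult_commute_abs)
  qed
  have E': "?E' s \<le> 0" if "s \<in> {a..t}" for s
  proof -
    have "(u s - v s) \<bullet> (f s (u s) - f s (v s)) \<le> norm (u s - v s) * (L * norm (u s - v s))"
      using L that by (intro order_trans[OF norm_cauchy_schwarz] mult_left_mono) auto
    then show ?thesis
      by (intro mult_nonneg_nonpos) (auto simp: dot_square_norm power2_eq_square algebra_simps)
  qed
  have "?E t \<le> ?E a"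
  proof (cases "a = t")
    case False
    then obtain s where "a < s" "s < t" "?E t - ?E a = ?E' s * (t - a)"
      using mean_value_half_line[of a ?E ?E' a t, OF D] t by auto
    then show ?thesis
      using E'[of s] mult_nonpos_nonneg[of "?E' s" "t - a"] by auto
  qed simp
  then have "(u t - v t) \<bullet> (u t - v t) \<le> 0"
    using init by (simp add: mult_le_0_iff)
  then have "(u t - v t) \<bullet> (u t - v t) = 0" using inner_ge_zero antisym by blast
  then show ?thesis by simp
qed

section \<open>The equation as a first-order system\<close>

locale quasi_equation =
  fixes a :: real and r p q :: "real \<Rightarrow> real"
  assumes cont_r: "continuous_on {a..} r" and cont_p: "continuous_on {a..} p"
    and cont_q: "continuous_on {a..} q"
    and r_pos: "\<And>x. x \<ge> a \<Longrightarrow> r x > 0" and p_pos: "\<And>x. x \<ge> a \<Longrightarrow> p x > 0"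
begin

text \<open>
  Here \<open>z\<close>, \<open>w\<close>, \<open>T\<close> stand for \<open>y'\<close>, \<open>r y''\<close> and the quasi-derivative \<open>T y\<close>. Written in these
  quantities the equation needs no derivatives of \<open>r\<close> and \<open>q\<close>, which need not exist.
\<close>
definition system_solution ::
  "(real \<Rightarrow> real) \<Rightarrow> (real \<Rightarrow> real) \<Rightarrow> (real \<Rightarrow> real) \<Rightarrow> (real \<Rightarrow> real) \<Rightarrow> bool" where
  "system_solution y z w T \<longleftrightarrow> (\<forall>x\<ge>a.
     (y has_real_derivative z x) (at x within {a..}) \<and>
     (z has_real_derivative w x / r x) (at x within {a..}) \<and>
     (w has_real_derivative T x + q x * z x) (at x within {a..}) \<and>
     (T has_real_derivative p x * y x) (at x within {a..}))"

lemma system_solutionD: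
  assumes "system_solution y z w T" "a \<le> x"
  shows "(y has_real_derivative z x) (at x within {a..})"
    "(z has_real_derivative w x / r x) (at x within {a..})"
    "(w has_real_derivative T x + q x * z x) (at x within {a..})"
    "(T has_real_derivative p x * y x) (at x within {a..})"
  using assms by (auto simp: system_solution_def)

lemma is_solution_imp_system_solution:
  assumes "is_solution a r q p y"
  shows "system_solution y (deriv_from a y) (quasi1 a r y) (quasiT a r q y)"
  unfolding system_solution_def
proof (intro allI impI conjI)
  fix x assume x: "a \<le> x"
  note S = assms[unfolded is_solution_def]
  show "(y has_real_derivative deriv_from a y x) (at x within {a..})"
    using S x C1_from_imp_derivative by blast
  have "(deriv_from a y has_real_derivative deriv_from a (deriv_from a y) x) (at x within {a..})"
    using S x C1_from_imp_derivative by blast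
  then show "(deriv_from a y has_real_derivative quasi1 a r y x / r x) (at x within {a..})"
    using r_pos[OF x] by (simp add: quasi1_def)
  have "(quasi1 a r y has_real_derivative deriv_from a (quasi1 a r y) x) (at x within {a..})"
    using S x C1_from_imp_derivative by blast
  then show "(quasi1 a r y has_real_derivative quasiT a r q y x + q x * deriv_from a y x)
      (at x within {a..})"
    by (simp add: quasiT_def)
  have "(quasiT a r q y has_real_derivative deriv_from a (quasiT a r q y) x) (at x within {a..})"
    using S x C1_from_imp_derivative by blast
  then show "(quasiT a r q y has_real_derivative p x * y x) (at x within {a..})"
    using S x by simp
qed

lemma system_solution_continuous:
  assumes "system_solution y z w T"
  shows "continuous_on {a..} y" "continuous_on {a..} z"
    "continuous_on {a..} w" "continuous_on {a..} T"
  by (rule DERIV_continuous_on, use system_solutionD[OF assms] in force)+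

lemma system_solution_imp_is_solution:
  assumes S: "system_solution y z w T"
  shows "is_solution a r q p y" "\<And>x. a \<le> x \<Longrightarrow> quasi1 a r y x = w x"
proof -
  note D = system_solutionD[OF S] and cont = system_solution_continuous[OF S]
  have transfer: "(g has_real_derivative d) (at x within {a..})"
    if "(f has_real_derivative d) (at x within {a..})" "a \<le> x" "\<And>t. a \<le> t \<Longrightarrow> g t = f t"
    for f g :: "real \<Rightarrow> real" and d x
    using that(1) unfolding has_field_derivative_def
    by (rule has_derivative_transform[rotated 2]) (use that in auto)
  have y': "deriv_from a y x = z x" if "a \<le> x" for x
    using D(1)[OF that] that by (rule deriv_from_eq)
  have Dz: "(deriv_from a y has_real_derivative w x / r x) (at x within {a..})" if "a \<le> x" for x
    using D(2)[OF that] that y' by (rule transfer)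
  show w: "quasi1 a r y x = w x" if "a \<le> x" for x
    using deriv_from_eq[OF Dz[OF that] that] r_pos[OF that] by (simp add: quasi1_def)
  have Dw: "(quasi1 a r y has_real_derivative T x + q x * z x) (at x within {a..})"
    if "a \<le> x" for x
    using D(3)[OF that] that w by (rule transfer)
  have T: "quasiT a r q y x = T x" if "a \<le> x" for x
    using deriv_from_eq[OF Dw[OF that] that] y'[OF that] by (simp add: quasiT_def)
  have DT: "(quasiT a r q y has_real_derivative p x * y x) (at x within {a..})"
    if "a \<le> x" for x
    using D(4)[OF that] that T by (rule transfer)
  have rne: "\<forall>x\<in>{a..}. r x \<noteq> 0" using r_pos by fastforce
  show "is_solution a r q p y"
    unfolding is_solution_def
  proof (intro conjI allI impI)
    show "C1_from a y" using D(1) cont(2) by (rule C1_fromI)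
    show "C1_from a (deriv_from a y)"
      using Dz by (rule C1_fromI) (auto intro!: continuous_intros cont cont_r simp: rne)
    show "C1_from a (quasi1 a r y)"
      using Dw by (rule C1_fromI) (auto intro!: continuous_intros cont cont_q)
    show "C1_from a (quasiT a r q y)"
      using DT by (rule C1_fromI) (auto intro!: continuous_intros cont cont_p)
    show "deriv_from a (quasiT a r q y) x = p x * y x" if "a \<le> x" for x
      using DT[OF that] that by (rule deriv_from_eq)
  qed
qed

text \<open>
  The same system as one equation in \<open>\<real>\<^sup>4\<close>, the form to which the results on initial value
  problems apply.
\<close>
definition system_rhs :: "real \<Rightarrow> real \<times> real \<times> real \<times> real \<Rightarrow> real \<times> real \<times> real \<times> real" where
  "system_rhs t = (\<lambda>(y, z, w, T). (z, w / r t, T + q t * z, p t * y))"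

lemma continuous_on_system_rhs:
  assumes "continuous_on {a..} u"
  shows "continuous_on {a..} (\<lambda>s. system_rhs s (u s))"
proof -
  have "\<forall>x\<in>{a..}. r x \<noteq> 0" using r_pos by fastforce
  then show ?thesis
    unfolding system_rhs_def case_prod_unfold
    by (intro continuous_intros assms cont_r cont_p cont_q)
qed

lemma bounded_on_Icc:
  fixes g :: "real \<Rightarrow> real"
  assumes "continuous_on {a..} g"
  obtains M where "M \<ge> 0" "\<And>s. s \<in> {a..b} \<Longrightarrow> \<bar>g s\<bar> \<le> M"
proof -
  have "compact (g ` {a..b})"
    using assms by (intro compact_continuous_image) (auto elim: continuous_on_subset)
  then obtain M where "\<forall>s\<in>{a..b}. \<bar>g s\<bar> \<le> M"
    by (auto dest!: compact_imp_bounded simp: bounded_iff)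
  then have "\<bar>g s\<bar> \<le> \<bar>M\<bar>" if "s \<in> {a..b}" for s
    using that abs_ge_self order_trans by blast
  then show thesis by (intro that[of "\<bar>M\<bar>"]) auto
qed

lemma system_rhs_lipschitz:
  "\<exists>L\<ge>0. \<forall>s\<in>{a..b}. \<forall>u v. norm (system_rhs s u - system_rhs s v) \<le> L * norm (u - v)"
proof -
  have "continuous_on {a..} (\<lambda>x. 1 / r x)"
    using r_pos by (intro continuous_intros cont_r) fastforce
  from bounded_on_Icc[OF this, of b] obtain R
    where R: "R \<ge> 0" "\<And>s. s \<in> {a..b} \<Longrightarrow> \<bar>1 / r s\<bar> \<le> R" by blast
  from bounded_on_Icc[OF cont_q, of b] obtain Q
    where Q: "Q \<ge> 0" "\<And>s. s \<in> {a..b} \<Longrightarrow> \<bar>q s\<bar> \<le> Q" by blast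
  from bounded_on_Icc[OF cont_p, of b] obtain P
    where P: "P \<ge> 0" "\<And>s. s \<in> {a..b} \<Longrightarrow> \<bar>p s\<bar> \<le> P" by blast
  have "norm (system_rhs s u - system_rhs s v) \<le> (1 + R + 1 + Q + P) * norm (u - v)"
    if s: "s \<in> {a..b}" for s u v
  proof -
    obtain y z w T where uv: "u - v = (y, z, w, T)" by (metis prod.exhaust)
    have n: "\<bar>y\<bar> \<le> norm (u - v)" "\<bar>z\<bar> \<le> norm (u - v)" "\<bar>w\<bar> \<le> norm (u - v)" "\<bar>T\<bar> \<le> norm (u - v)"
      unfolding uv
      using norm_fst_le[of y "(z, w, T)"] norm_snd_le[of "(z, w, T)" y]
        norm_fst_le[of z "(w, T)"] norm_snd_le[of "(w, T)" z]
        norm_fst_le[of w T] norm_snd_le[of T w] by auto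
    have "system_rhs s u - system_rhs s v = (z, 1 / r s * w, T + q s * z, p s * y)"
      using uv by (auto simp: system_rhs_def case_prod_unfold algebra_simps diff_divide_distrib
          prod_eq_iff add_divide_distrib)
    also have "norm \<dots> \<le> \<bar>z\<bar> + \<bar>1 / r s * w\<bar> + \<bar>T + q s * z\<bar> + \<bar>p s * y\<bar>"
      using norm_Pair_le[of z "(1 / r s * w, T + q s * z, p s * y)"]
        norm_Pair_le[of "1 / r s * w" "(T + q s * z, p s * y)"]
        norm_Pair_le[of "T + q s * z" "p s * y"] by simp
    also have "\<dots> \<le> \<bar>z\<bar> + \<bar>1 / r s\<bar> * \<bar>w\<bar> + (\<bar>T\<bar> + \<bar>q s\<bar> * \<bar>z\<bar>) + \<bar>p s\<bar> * \<bar>y\<bar>"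
      using abs_triangle_ineq[of T "q s * z"] by (simp add: abs_mult)
    also have "\<dots> \<le> norm (u - v) + R * norm (u - v) + (norm (u - v) + Q * norm (u - v))
        + P * norm (u - v)"
      using n R Q P s by (intro add_mono mult_mono) auto
    finally show ?thesis by (simp add: algebra_simps)
  qed
  then show ?thesis using R Q P by (intro exI[of _ "1 + R + 1 + Q + P"]) auto
qed

lemma system_solution_exists:
  obtains y z w T where "system_solution y z w T" "y a = y0" "z a = z0" "w a = w0" "T a = T0"
proof -
  obtain \<phi> where init: "\<phi> a = (y0, z0, w0, T0)"
    and \<phi>: "\<And>t. t \<ge> a \<Longrightarrow> (\<phi> has_vector_derivative system_rhs t (\<phi> t)) (at t within {a..})"
    using initial_value_problem_global[of a system_rhs "(y0, z0, w0, T0)"]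
      continuous_on_system_rhs system_rhs_lipschitz by blast
  define y z w T where "y = (\<lambda>t. fst (\<phi> t))" and "z = (\<lambda>t. fst (snd (\<phi> t)))"
    and "w = (\<lambda>t. fst (snd (snd (\<phi> t))))" and "T = (\<lambda>t. snd (snd (snd (\<phi> t))))"
  note defs = y_def z_def w_def T_def
  note [simp] = has_real_derivative_iff_has_vector_derivative
  note fst = bounded_linear.has_vector_derivative[OF bounded_linear_fst]
    and snd = bounded_linear.has_vector_derivative[OF bounded_linear_snd]
  have "system_solution y z w T"
    unfolding system_solution_def
  proof (intro allI impI conjI)
    fix x assume x: "a \<le> x"
    note eq = system_rhs_def case_prod_unfold defs
    show "(y has_real_derivative z x) (at x within {a..})"
      using fst[OF \<phi>[OF x]] by (simp add: eq)
    show "(z has_real_derivative w x / r x) (at x within {a..})"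
      using fst[OF snd[OF \<phi>[OF x]]] by (simp add: eq)
    show "(w has_real_derivative T x + q x * z x) (at x within {a..})"
      using fst[OF snd[OF snd[OF \<phi>[OF x]]]] by (simp add: eq)
    show "(T has_real_derivative p x * y x) (at x within {a..})"
      using snd[OF snd[OF snd[OF \<phi>[OF x]]]] by (simp add: eq)
  qed
  then show thesis by (rule that) (simp_all add: defs init)
qed

lemma system_solution_unique:
  assumes "system_solution y z w T" "system_solution y' z' w' T'"
    and init: "y a = y' a" "z a = z' a" "w a = w' a" "T a = T' a" and "a \<le> x"
  shows "y x = y' x" "z x = z' x" "w x = w' x" "T x = T' x"
proof -
  have D: "((\<lambda>t. (y t, z t, w t, T t)) has_vector_derivative system_rhs t (y t, z t, w t, T t))
      (at t within {a..})" if "system_solution y z w T" "a \<le> t" for y z w T t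
    using system_solutionD[OF that]
    by (auto simp: system_rhs_def has_real_derivative_iff_has_vector_derivative
        intro!: has_vector_derivative_Pair)
  have "(y x, z x, w x, T x) = (y' x, z' x, w' x, T' x)"
    by (rule initial_value_problem_unique[where f = system_rhs and a = a])
       (use D assms system_rhs_lipschitz in auto)
  then show "y x = y' x" "z x = z' x" "w x = w' x" "T x = T' x" by auto
qed

lemma system_solution_linear_combination:
  assumes "system_solution y1 z1 w1 T1" "system_solution y2 z2 w2 T2"
  shows "system_solution (\<lambda>x. c * y1 x + d * y2 x) (\<lambda>x. c * z1 x + d * z2 x)
    (\<lambda>x. c * w1 x + d * w2 x) (\<lambda>x. c * T1 x + d * T2 x)"
  unfolding system_solution_def
proof (intro allI impI conjI)
  fix x assume x: "a \<le> x"
  note comb = DERIV_add[OF DERIV_cmult[where c = c] DERIV_cmult[where c = d]]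
  note d1 = system_solutionD[OF assms(1) x] and d2 = system_solutionD[OF assms(2) x]
  show "((\<lambda>x. c * y1 x + d * y2 x) has_real_derivative c * z1 x + d * z2 x) (at x within {a..})"
    by (rule comb[OF d1(1) d2(1)])
  show "((\<lambda>x. c * z1 x + d * z2 x) has_real_derivative (c * w1 x + d * w2 x) / r x)
      (at x within {a..})"
    using comb[OF d1(2) d2(2)] by (simp add: add_divide_distrib)
  show "((\<lambda>x. c * w1 x + d * w2 x) has_real_derivative
      c * T1 x + d * T2 x + q x * (c * z1 x + d * z2 x)) (at x within {a..})"
    using comb[OF d1(3) d2(3)] by (simp add: algebra_simps)
  show "((\<lambda>x. c * T1 x + d * T2 x) has_real_derivative p x * (c * y1 x + d * y2 x))
      (at x within {a..})"
    using comb[OF d1(4) d2(4)] by (simp add: algebra_simps)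
qed

section \<open>Pluecker coordinates of the plane of solutions\<close>

text \<open>
  By uniqueness the solutions with \<open>y = w = 0\<close> at \<open>a\<close> are exactly the linear combinations of the two
  given ones, so a conjugate point is a zero of the determinant of their boundary values. A
  nontrivial combination is a nontrivial function, because \<open>y = 0\<close> forces \<open>z\<close>, \<open>w\<close> and \<open>T\<close> to vanish in turn.
\<close>
lemma conjugate_iff_determinant_zero:
  assumes s1: "system_solution y1 z1 w1 T1" "y1 a = 0" "z1 a = 1" "w1 a = 0" "T1 a = 0"
    and s2: "system_solution y2 z2 w2 T2" "y2 a = 0" "z2 a = 0" "w2 a = 0" "T2 a = 1"
    and b: "a < b"
  shows "systems_conjugate_to a r q p b \<longleftrightarrow> y1 b * w2 b - y2 b * w1 b = 0"
proof
  assume "systems_conjugate_to a r q p b"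
  then obtain y where y: "is_solution a r q p y" "y a = 0" "quasi1 a r y a = 0"
      "y b = 0" "quasi1 a r y b = 0" and nz: "\<exists>x\<ge>a. y x \<noteq> 0"
    by (auto simp: systems_conjugate_to_def)
  define c d where "c = deriv_from a y a" and "d = quasiT a r q y a"
  have init: "y a = c * y1 a + d * y2 a" "deriv_from a y a = c * z1 a + d * z2 a"
    "quasi1 a r y a = c * w1 a + d * w2 a" "quasiT a r q y a = c * T1 a + d * T2 a"
    using y s1 s2 by (simp_all add: c_def d_def)
  have comb: "y x = c * y1 x + d * y2 x" "quasi1 a r y x = c * w1 x + d * w2 x" if "a \<le> x" for x
    by (rule system_solution_unique(1,3)[OF is_solution_imp_system_solution[OF y(1)]
          system_solution_linear_combination[OF s1(1) s2(1), of c d] init that])+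
  have "c \<noteq> 0 \<or> d \<noteq> 0" using nz comb(1) by auto
  moreover have yw: "c * y1 b + d * y2 b = 0" "c * w1 b + d * w2 b = 0"
    using comb[of b] y b by auto
  have "c * (y1 b * w2 b - y2 b * w1 b)
      = w2 b * (c * y1 b + d * y2 b) - y2 b * (c * w1 b + d * w2 b)"
    "d * (y1 b * w2 b - y2 b * w1 b)
      = y1 b * (c * w1 b + d * w2 b) - w1 b * (c * y1 b + d * y2 b)"
    by (simp_all add: algebra_simps)
  then have "c * (y1 b * w2 b - y2 b * w1 b) = 0" "d * (y1 b * w2 b - y2 b * w1 b) = 0"
    unfolding yw by simp_all
  ultimately show "y1 b * w2 b - y2 b * w1 b = 0" by auto
next
  assume det: "y1 b * w2 b - y2 b * w1 b = 0"
  obtain c d where cd: "c \<noteq> 0 \<or> d \<noteq> 0" "c * y1 b + d * y2 b = 0" "c * w1 b + d * w2 b = 0"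
  proof (cases "y1 b = 0 \<and> y2 b = 0")
    case True
    then show thesis
      using that[of "w2 b" "- w1 b"] that[of 1 0] by (cases "w1 b = 0 \<and> w2 b = 0") auto
  next
    case False
    then show thesis
      using that[of "y2 b" "- y1 b"] det by (auto simp: algebra_simps)
  qed
  let ?y = "\<lambda>x. c * y1 x + d * y2 x" and ?w = "\<lambda>x. c * w1 x + d * w2 x"
  note S = system_solution_linear_combination[OF s1(1) s2(1), of c d]
  have "\<exists>x\<ge>a. ?y x \<noteq> 0"
  proof (rule ccontr)
    assume "\<not> (\<exists>x\<ge>a. ?y x \<noteq> 0)"
    then have y0: "?y x = 0" if "a \<le> x" for x using that by blast
    have zero: "g x = 0"
      if "(f has_real_derivative g x) (at x within {a..})" "\<And>x. a \<le> x \<Longrightarrow> f x = 0" "a \<le> x"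
      for f g :: "real \<Rightarrow> real" and x
    proof -
      have "((\<lambda>_. 0) has_real_derivative g x) (at x within {a..})"
        using that(1) unfolding has_field_derivative_def
        by (rule has_derivative_transform[rotated 2]) (use that in auto)
      then have "deriv_from a (\<lambda>_. 0) x = g x" using that(3) by (rule deriv_from_eq)
      moreover have "deriv_from a (\<lambda>_. 0) x = 0" using that(3) by (intro deriv_from_eq) auto
      ultimately show ?thesis by simp
    qed
    have z0: "c * z1 x + d * z2 x = 0" if "a \<le> x" for x
      by (rule zero[where f = ?y]) (use system_solutionD(1)[OF S that] y0 that in auto)
    have w0: "?w x = 0" if "a \<le> x" for x
      using zero[where f = "\<lambda>x. c * z1 x + d * z2 x" and g = "\<lambda>x. ?w x / r x", of x]
        system_solutionD(2)[OF S that] z0 that r_pos[OF that] by simp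
    have "c * T1 x + d * T2 x = 0" if "a \<le> x" for x
      using zero[where f = ?w
          and g = "\<lambda>x. c * T1 x + d * T2 x + q x * (c * z1 x + d * z2 x)", of x]
        system_solutionD(3)[OF S that] w0 z0[OF that] that by simp
    from this[of a] z0[of a] cd(1) show False using s1 s2 by auto
  qed
  moreover have "is_solution a r q p ?y" by (rule system_solution_imp_is_solution(1)[OF S])
  moreover have "?y a = 0" "quasi1 a r ?y a = 0" "?y b = 0" "quasi1 a r ?y b = 0"
    using cd s1 s2 b system_solution_imp_is_solution(2)[OF S, of a]
      system_solution_imp_is_solution(2)[OF S, of b] by simp_all
  ultimately show "systems_conjugate_to a r q p b"
    unfolding systems_conjugate_to_def using b by blast
qed

text \<open>
  For two solutions with \<open>y = w = 0\<close> at \<open>a\<close> and \<open>(z, T) = (1, 0)\<close>, \<open>(0, 1)\<close> there, the \<open>2 \<times> 2\<close> minors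
  \<^item> \<open>D = y\<^sub>1 w\<^sub>2 - y\<^sub>2 w\<^sub>1\<close> and \<open>V = z\<^sub>1 T\<^sub>2 - z\<^sub>2 T\<^sub>1\<close>,
  \<^item> \<open>A = w\<^sub>1 T\<^sub>2 - w\<^sub>2 T\<^sub>1\<close>, \<open>C = y\<^sub>2 z\<^sub>1 - y\<^sub>1 z\<^sub>2\<close>,
  \<^item> \<open>B = w\<^sub>2 z\<^sub>1 - w\<^sub>1 z\<^sub>2 = y\<^sub>1 T\<^sub>2 - y\<^sub>2 T\<^sub>1\<close>

  satisfy a closed linear system. The two expressions for \<open>B\<close> agree because the plane of solutions is
  Lagrangian, and the algebraic equation is then the Pluecker relation between the six minors. Where \<open>V \<noteq> 0\<close>,
  the symmetric matrix with entries \<open>A / V\<close>, \<open>B / V\<close>, \<open>C / V\<close> maps \<open>(z, T)\<close> to \<open>(w, y)\<close> along the plane,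
  and its determinant is \<open>- D / V\<close>.
\<close>
definition pluecker_system ::
  "(real \<Rightarrow> real) \<Rightarrow> (real \<Rightarrow> real) \<Rightarrow> (real \<Rightarrow> real) \<Rightarrow> (real \<Rightarrow> real) \<Rightarrow> (real \<Rightarrow> real) \<Rightarrow> bool" where
  "pluecker_system D V A B C \<longleftrightarrow>
     (\<forall>x\<ge>a.
       (D has_real_derivative 2 * B x - q x * C x) (at x within {a..}) \<and>
       (V has_real_derivative A x / r x + p x * C x) (at x within {a..}) \<and>
       (A has_real_derivative q x * V x - p x * D x) (at x within {a..}) \<and>
       (B has_real_derivative V x) (at x within {a..}) \<and>
       (C has_real_derivative - D x / r x) (at x within {a..}) \<and>
       A x * C x - (B x)\<^sup>2 + D x * V x = 0) \<and>
     D a = 0 \<and> V a = 1 \<and> A a = 0 \<and> B a = 0 \<and> C a = 0"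

lemma pluecker_system_exists:
  obtains D V A B C where "pluecker_system D V A B C"
    "\<And>b. a < b \<Longrightarrow> systems_conjugate_to a r q p b \<longleftrightarrow> D b = 0"
proof -
  obtain y1 z1 w1 T1 where s1: "system_solution y1 z1 w1 T1" "y1 a = 0" "z1 a = 1" "w1 a = 0" "T1 a = 0"
    by (rule system_solution_exists)
  obtain y2 z2 w2 T2 where s2: "system_solution y2 z2 w2 T2" "y2 a = 0" "z2 a = 0" "w2 a = 0" "T2 a = 1"
    by (rule system_solution_exists)
  note d1 = system_solutionD[OF s1(1)] and d2 = system_solutionD[OF s2(1)]
  let ?B = "\<lambda>x. w2 x * z1 x - w1 x * z2 x"
  \<comment> \<open>The Lagrange identity: this bilinear expression is constant for every pair of solutions.\<close>
  let ?F = "\<lambda>x. y1 x * T2 x - y2 x * T1 x - ?B x"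
  have F: "?F x = 0" if "a \<le> x" for x
  proof (cases "a = x")
    case False
    have "(?F has_real_derivative 0) (at t within {a..})" if "a \<le> t" for t
    proof (rule DERIV_cong)
      note d = d1[OF that] d2[OF that]
      show "(?F has_real_derivative (z1 t * T2 t + p t * y2 t * y1 t - (z2 t * T1 t + p t * y1 t * y2 t))
          - ((T2 t + q t * z2 t) * z1 t + w1 t / r t * w2 t
            - ((T1 t + q t * z1 t) * z2 t + w2 t / r t * w1 t))) (at t within {a..})"
        by (intro DERIV_diff DERIV_mult d)
    qed (simp add: algebra_simps)
    with mean_value_half_line[of a ?F "\<lambda>_. 0" a x] False that s1 s2 show ?thesis by force
  qed (use s1 s2 in auto)
  show thesis
  proof (rule that)
    show "pluecker_system (\<lambda>x. y1 x * w2 x - y2 x * w1 x) (\<lambda>x. z1 x * T2 x - z2 x * T1 x)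
        (\<lambda>x. w1 x * T2 x - w2 x * T1 x) ?B (\<lambda>x. y2 x * z1 x - y1 x * z2 x)"
      unfolding pluecker_system_def
    proof (intro conjI allI impI)
      fix x assume x: "a \<le> x"
      note wronskian = DERIV_cong[OF DERIV_diff[OF DERIV_mult DERIV_mult]]
      note d1 = d1[OF x] and d2 = d2[OF x]
      have Fx: "y1 x * T2 x - y2 x * T1 x = ?B x" using F[OF x] by simp
      show "((\<lambda>x. y1 x * w2 x - y2 x * w1 x) has_real_derivative
          2 * ?B x - q x * (y2 x * z1 x - y1 x * z2 x)) (at x within {a..})"
        by (rule wronskian[OF d1(1) d2(3) d2(1) d1(3)]) (use Fx in algebra)
      show "((\<lambda>x. z1 x * T2 x - z2 x * T1 x) has_real_derivative
          (w1 x * T2 x - w2 x * T1 x) / r x + p x * (y2 x * z1 x - y1 x * z2 x)) (at x within {a..})"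
        by (rule wronskian[OF d1(2) d2(4) d2(2) d1(4)]) (simp add: algebra_simps diff_divide_distrib)
      show "((\<lambda>x. w1 x * T2 x - w2 x * T1 x) has_real_derivative
          q x * (z1 x * T2 x - z2 x * T1 x) - p x * (y1 x * w2 x - y2 x * w1 x)) (at x within {a..})"
        by (rule wronskian[OF d1(3) d2(4) d2(3) d1(4)]) (simp add: algebra_simps)
      show "(?B has_real_derivative z1 x * T2 x - z2 x * T1 x) (at x within {a..})"
        by (rule wronskian[OF d2(3) d1(2) d1(3) d2(2)]) (simp add: algebra_simps)
      show "((\<lambda>x. y2 x * z1 x - y1 x * z2 x) has_real_derivative
          - (y1 x * w2 x - y2 x * w1 x) / r x) (at x within {a..})"
        by (rule wronskian[OF d2(1) d1(2) d1(1) d2(2)]) (simp add: algebra_simps diff_divide_distrib)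
      have "(w1 x * T2 x - w2 x * T1 x) * (y2 x * z1 x - y1 x * z2 x) - ?B x * (y1 x * T2 x - y2 x * T1 x)
          + (y1 x * w2 x - y2 x * w1 x) * (z1 x * T2 x - z2 x * T1 x) = 0"
        by algebra
      then show "(w1 x * T2 x - w2 x * T1 x) * (y2 x * z1 x - y1 x * z2 x) - (?B x)\<^sup>2
          + (y1 x * w2 x - y2 x * w1 x) * (z1 x * T2 x - z2 x * T1 x) = 0"
        using Fx by (simp add: power2_eq_square)
    qed (use s1 s2 in simp_all)
  next
    fix b assume "a < b"
    then show "systems_conjugate_to a r q p b \<longleftrightarrow> y1 b * w2 b - y2 b * w1 b = 0"
      using conjugate_iff_determinant_zero s1 s2 by blast
  qed
qed

section \<open>Zeros of the determinant\<close>

context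
  fixes D V A B C
  assumes coord: "pluecker_system D V A B C"
begin

lemma pluecker_derivatives:
  assumes "a \<le> x"
  shows "(D has_real_derivative 2 * B x - q x * C x) (at x within {a..})"
    "(V has_real_derivative A x / r x + p x * C x) (at x within {a..})"
    "(A has_real_derivative q x * V x - p x * D x) (at x within {a..})"
    "(B has_real_derivative V x) (at x within {a..})"
    "(C has_real_derivative - D x / r x) (at x within {a..})"
  using coord assms by (auto simp: pluecker_system_def)

lemma pluecker_relation: "a \<le> x \<Longrightarrow> A x * C x - (B x)\<^sup>2 + D x * V x = 0"
  using coord by (auto simp: pluecker_system_def)

lemma pluecker_at_start: "D a = 0" "V a = 1" "A a = 0" "B a = 0" "C a = 0"
  using coord by (auto simp: pluecker_system_def)

lemma continuous_on_D: "continuous_on {a..} D" and continuous_on_V: "continuous_on {a..} V"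
  by (rule DERIV_continuous_on, use pluecker_derivatives in force)+

text \<open>
  Near \<open>a\<close> the determinant behaves like \<open>(x - a)\<^sup>2\<close>: \<open>B' = V \<approx> 1\<close> makes \<open>2 B\<close> at least \<open>x - a\<close>, whereas
  \<open>C' = - D / r\<close> tends to zero, so that \<open>q C\<close> is of smaller order and \<open>D' = 2 B - q C\<close> is positive.
\<close>
lemma determinant_pos_near_start:
  obtains e where "e > 0" "\<And>x. a < x \<Longrightarrow> x < a + e \<Longrightarrow> D x > 0"
proof -
  define K where "K = \<bar>q a\<bar> + 1"
  have K: "K > 0" by (simp add: K_def)
  have "\<forall>x\<in>{a..}. r x \<noteq> 0" using r_pos by fastforce
  then have "continuous_on {a..} (\<lambda>x. D x / r x)"
    by (intro continuous_intros continuous_on_D cont_r)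
  then have lim: "((\<lambda>x. D x / r x) \<longlongrightarrow> D a / r a) (at a within {a..})"
    "(V \<longlongrightarrow> V a) (at a within {a..})" "((\<lambda>x. \<bar>q x\<bar>) \<longlongrightarrow> \<bar>q a\<bar>) (at a within {a..})"
    using continuous_on_V cont_q by (auto simp: continuous_on_def intro!: tendsto_intros)
  have "\<forall>\<^sub>F x in at a within {a..}. D x / r x < 1 / (2 * K) \<and> V x > 1 / 2 \<and> \<bar>q x\<bar> < K"
    using K pluecker_at_start
    by (intro eventually_conj order_tendstoD[OF lim(1)] order_tendstoD[OF lim(2)]
        order_tendstoD[OF lim(3)]) (auto simp: K_def)
  moreover have "\<forall>\<^sub>F x in at a within {a..}. - (1 / (2 * K)) < D x / r x"
    using K pluecker_at_start by (intro order_tendstoD[OF lim(1)]) auto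
  ultimately have "\<forall>\<^sub>F x in at a within {a..}. \<bar>D x / r x\<bar> < 1 / (2 * K) \<and> V x > 1 / 2 \<and> \<bar>q x\<bar> < K"
    by eventually_elim auto
  then obtain e where e: "e > 0" and near: "\<And>x. a < x \<Longrightarrow> x < a + e \<Longrightarrow>
      \<bar>D x / r x\<bar> < 1 / (2 * K) \<and> V x > 1 / 2 \<and> \<bar>q x\<bar> < K"
    unfolding eventually_at by (auto simp: dist_real_def)
  show thesis
  proof (rule that[OF e])
    fix x assume x: "a < x" "x < a + e"
    obtain s where s: "a < s" "s < x" "D x - D a = (2 * B s - q s * C s) * (x - a)"
      using mean_value_half_line[OF pluecker_derivatives(1) order_refl x(1)] by blast
    obtain t where t: "a < t" "t < s" "B s - B a = V t * (s - a)"
      using mean_value_half_line[OF pluecker_derivatives(4) order_refl s(1)] by blast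
    obtain t' where t': "a < t'" "t' < s" "C s - C a = - D t' / r t' * (s - a)"
      using mean_value_half_line[OF pluecker_derivatives(5) order_refl s(1)] by blast
    have "2 * B s > s - a"
      using t s x near[of t] pluecker_at_start mult_strict_right_mono[of "1/2" "V t" "s - a"] by auto
    moreover have "\<bar>q s * C s\<bar> \<le> K * (1 / (2 * K) * (s - a))"
    proof -
      have "\<bar>C s\<bar> = \<bar>D t' / r t'\<bar> * (s - a)"
        using t'(3) s(1) pluecker_at_start by (simp add: abs_mult)
      also have "\<dots> \<le> 1 / (2 * K) * (s - a)"
        using near[of t'] t' s x by (intro mult_right_mono) auto
      finally show ?thesis
        unfolding abs_mult using near[of s] s x K by (intro mult_mono) auto
    qed
    then have "\<bar>q s * C s\<bar> \<le> (s - a) / 2" using K by simp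
    ultimately have "2 * B s - q s * C s > 0" using s(1) by (auto simp: abs_le_iff)
    then show "D x > 0" using s(3) x pluecker_at_start by simp
  qed
qed

text \<open>
  If \<open>D\<close> had no zero it would stay positive, and \<open>C' = - D / r\<close> would keep \<open>C\<close> negative. Then two Riccati
  inequalities, one for each divergence assumption, collide. The first is
  \<open>(V / C)' = p + B\<^sup>2 / (r C\<^sup>2) \<ge> p\<close>: it drives \<open>V / C\<close> to \<open>\<infinity>\<close>, so \<open>V\<close> is eventually negative, and then so is
  \<open>A\<close>, by \<open>A C = B\<^sup>2 - D V > 0\<close>. The second is \<open>(A / V)' = q - (A\<^sup>2 / r + p B\<^sup>2) / V\<^sup>2 \<le> q\<close>: it drives \<open>A / V\<close> to
  \<open>- \<infinity>\<close>, although a quotient of two negative numbers is positive.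
\<close>
lemma determinant_zero_exists:
  assumes q_lim: "filterlim (\<lambda>x. integral {a..x} q) at_bot at_top"
    and p_lim: "filterlim (\<lambda>x. integral {a..x} p) at_top at_top"
  obtains b where "a < b" "D b = 0"
proof -
  have False if nz: "\<And>b. a < b \<Longrightarrow> D b \<noteq> 0"
  proof -
    have D_pos: "D x > 0" if x: "a < x" for x
    proof (rule ccontr)
      assume "\<not> D x > 0"
      obtain e where e: "e > 0" "\<And>x. a < x \<Longrightarrow> x < a + e \<Longrightarrow> D x > 0"
        using determinant_pos_near_start by blast
      define u where "u = min x (a + e / 2)"
      have u: "a < u" "u \<le> x" "D u > 0" using e(2)[of u] e(1) x by (auto simp: u_def min_def)
      have "continuous_on {u..x} D"
        using continuous_on_D by (rule continuous_on_subset) (use u in auto)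
      then obtain v where "u \<le> v" "v \<le> x" "D v = 0"
        using IVT2'[of D x 0 u] \<open>\<not> D x > 0\<close> u by auto
      then show False using nz[of v] u by auto
    qed
    have C_neg: "C x < 0" if x: "a < x" for x
    proof -
      obtain s where "a < s" "s < x" "C x - C a = - D s / r s * (x - a)"
        using mean_value_half_line[OF pluecker_derivatives(5) order_refl x] by blast
      moreover from this have "D s / r s * (x - a) > 0" using D_pos[of s] r_pos[of s] x by simp
      ultimately show ?thesis using pluecker_at_start by simp
    qed
    let ?P = "\<lambda>x. integral {a..x} p" and ?Q = "\<lambda>x. integral {a..x} q"
    \<comment> \<open>Since \<open>C\<close> vanishes at \<open>a\<close>, the quotient is considered away from the left end point.\<close>
    let ?c = "a + 1"
    let ?g = "\<lambda>x. V x / C x - ?P x"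
    have g': "(?g has_real_derivative (B x)\<^sup>2 / (r x * (C x)\<^sup>2)) (at x within {a..})"
      if "?c \<le> x" for x
    proof -
      have x: "a \<le> x" "a < x" using that by auto
      have "(?g has_real_derivative
          ((A x / r x + p x * C x) * C x - V x * (- D x / r x)) / (C x * C x) - p x) (at x within {a..})"
        using C_neg[OF x(2)] integral_has_real_derivative_half_line[OF cont_p x(1)]
        by (intro derivative_intros pluecker_derivatives x) auto
      moreover have "((A x / r x + p x * C x) * C x - V x * (- D x / r x)) / (C x * C x) - p x
          = (A x * C x + D x * V x) / (r x * (C x)\<^sup>2)"
        using C_neg[OF x(2)] r_pos[OF x(1)] by (simp add: field_simps power2_eq_square)
      moreover have "A x * C x + D x * V x = (B x)\<^sup>2" using pluecker_relation[OF x(1)] by simp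
      ultimately show ?thesis by simp
    qed
    have g_mono: "?g ?c \<le> ?g x" if "?c \<le> x" for x
    proof (rule half_line_nondecreasing[OF g'])
      show "(B t)\<^sup>2 / (r t * (C t)\<^sup>2) \<ge> 0" if "?c < t" for t
        using r_pos[of t] that by simp
    qed (use that in auto)
    obtain X0 where X0: "\<And>x. X0 \<le> x \<Longrightarrow> ?P x \<ge> 1 - ?g ?c"
      using p_lim unfolding filterlim_at_top eventually_at_top_linorder by metis
    define X where "X = max X0 ?c"
    have X: "X \<ge> ?c" "X > a" by (auto simp: X_def)
    have V_neg: "V x < 0" if "X \<le> x" for x
    proof -
      have "V x / C x > 0" using g_mono[of x] X0[of x] that by (auto simp: X_def)
      then show ?thesis using C_neg[of x] X that by (auto simp: zero_less_divide_iff)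
    qed
    have A_neg: "A x < 0" if "X \<le> x" for x
    proof -
      have "D x * V x < 0" using D_pos[of x] V_neg[OF that] X that by (simp add: mult_pos_neg)
      moreover have "a \<le> x" using X that by simp
      ultimately have "A x * C x > 0"
        using pluecker_relation[of x] zero_le_power2[of "B x"] by linarith
      then show ?thesis using C_neg[of x] X that by (auto simp: zero_less_mult_iff)
    qed
    let ?h = "\<lambda>x. ?Q x - A x / V x"
    have h': "(?h has_real_derivative ((A x)\<^sup>2 / r x + p x * (B x)\<^sup>2) / (V x)\<^sup>2) (at x within {a..})"
      if "X \<le> x" for x
    proof -
      have x: "a \<le> x" using that X by auto
      have "(?h has_real_derivative q x -
          ((q x * V x - p x * D x) * V x - A x * (A x / r x + p x * C x)) / (V x * V x)) (at x within {a..})"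
        using V_neg[OF that] integral_has_real_derivative_half_line[OF cont_q x]
        by (intro derivative_intros pluecker_derivatives x) auto
      moreover have "q x - ((q x * V x - p x * D x) * V x - A x * (A x / r x + p x * C x)) / (V x * V x)
          = ((A x)\<^sup>2 / r x + p x * (A x * C x + D x * V x)) / (V x)\<^sup>2"
        using V_neg[OF that] r_pos[OF x] by (simp add: field_simps power2_eq_square)
      moreover have "A x * C x + D x * V x = (B x)\<^sup>2" using pluecker_relation[OF x] by simp
      ultimately show ?thesis by simp
    qed
    have h_mono: "?h X \<le> ?h x" if "X \<le> x" for x
    proof (rule half_line_nondecreasing[OF h'])
      fix t assume "X < t"
      then have "r t > 0" "p t > 0" using r_pos[of t] p_pos[of t] X by auto
      then show "((A t)\<^sup>2 / r t + p t * (B t)\<^sup>2) / (V t)\<^sup>2 \<ge> 0" by simp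
    qed (use X that in auto)
    obtain Y0 where Y0: "\<And>x. Y0 \<le> x \<Longrightarrow> ?Q x \<le> ?h X"
      using q_lim unfolding filterlim_at_bot eventually_at_top_linorder by metis
    define Y where "Y = max Y0 X"
    have "A Y / V Y \<le> 0" using h_mono[of Y] Y0[of Y] by (simp add: Y_def)
    moreover have "A Y / V Y > 0" using A_neg[of Y] V_neg[of Y] by (simp add: Y_def divide_neg_neg)
    ultimately show False by simp
  qed
  then show thesis using that by blast
qed

text \<open>
  Zeros of \<open>D\<close> cannot accumulate at \<open>a\<close>, so those to the right of \<open>a\<close> form a closed set.
\<close>
lemma least_determinant_zero:
  assumes "a < b" "D b = 0"
  obtains c where "a < c" "D c = 0" "\<And>x. a < x \<Longrightarrow> D x = 0 \<Longrightarrow> c \<le> x"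
proof -
  obtain e where e: "e > 0" "\<And>x. a < x \<Longrightarrow> x < a + e \<Longrightarrow> D x > 0"
    using determinant_pos_near_start by blast
  let ?Z = "{x \<in> {a + e..}. D x = 0}"
  have Z: "x \<in> ?Z" if "a < x" "D x = 0" for x
    using e(2)[of x] that by force
  have "continuous_on {a + e..} D"
    using continuous_on_D by (rule continuous_on_subset) (use e in auto)
  then have "closed ?Z"
    by (rule continuous_closed_preimage_constant) auto
  moreover have ne: "?Z \<noteq> {}" and bdd: "bdd_below ?Z"
    using Z[OF assms] by (blast, auto intro: bdd_belowI[of _ "a + e"])
  ultimately have "Inf ?Z \<in> ?Z" by (intro closed_contains_Inf)
  then show thesis
    using e(1) Z cInf_lower[OF _ bdd] by (intro that[of "Inf ?Z"]) auto
qed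

end

end

theorem theorem5p1:
  fixes a :: real and r p q :: "real \<Rightarrow> real"
  assumes "a \<ge> 0"
    and "continuous_on {a..} r" and "continuous_on {a..} p" and "continuous_on {a..} q"
    and "\<And>x. x \<ge> a \<Longrightarrow> r x > 0" and "\<And>x. x \<ge> a \<Longrightarrow> p x > 0"
    and "filterlim (\<lambda>x. integral {a..x} q) at_bot at_top"
    and "filterlim (\<lambda>x. integral {a..x} p) at_top at_top"
  shows "systems_conjugate a r q p"
proof -
  interpret quasi_equation a r p q
    by unfold_locales (use assms in auto)
  obtain D V A B C where coord: "pluecker_system D V A B C"
    and conj: "\<And>b. a < b \<Longrightarrow> systems_conjugate_to a r q p b \<longleftrightarrow> D b = 0"
    using pluecker_system_exists by blast
  obtain b where "a < b" "D b = 0"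
    using determinant_zero_exists[OF coord assms(7,8)] by blast
  then obtain c where c: "a < c" "D c = 0" "\<And>x. a < x \<Longrightarrow> D x = 0 \<Longrightarrow> c \<le> x"
    using least_determinant_zero[OF coord] by blast
  have "c \<le> x" if "systems_conjugate_to a r q p x" for x
    using c(3)[of x] conj[of x] that by (auto simp: systems_conjugate_to_def)
  then show ?thesis
    unfolding systems_conjugate_def is_systems_conjugate_point_def using c conj by blast
qed

end
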